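(* Let $\Lambda = \{\lambda_i\}_{i=1}^\infty$ be a strictly increasing sequence of positive real numbers with $\lambda_i \to \infty$. Then the closed linear span $Z := \overline{\operatorname{span}}\{1, x^{\lambda_1}, x^{\lambda_2}, \dots\}$ in $C[0,1]$ is not a poor subspace of $C[0,1]$; that is, there exists a closed subspace $\tilde{Z} \subset Z$ such that the quotient $C[0,1]/\tilde{Z}$ does not have the Daugavet property.
   Context: $C[0,1]$ is the real Banach space of continuous functions on $[0,1]$ with the supremum norm; $x^{\lambda}$ denotes the function $x \mapsto x^{\lambda}$ on $[0,1]$. A normed space $X$ has the Daugavet property if $\|\mathrm{Id} + T\| = 1 + \|T\|$ for every (bounded linear) rank-one operator $T \colon X \to X$; $C[0,1]$ has the Daugavet property. For a Banach space $X$ with the Daugavet property, a closed subspace $Z \subset X$ is called poor if $X/\tilde{Z}$ has the Daugavet property for every closed subspace $\tilde{Z} \subset Z$. Quotients carry the quotient norm. *)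

theory Defs
  imports "HOL-Analysis.Analysis" "HOL-Library.Set_Algebras"
begin

section \<open>The space of continuous functions on the unit interval\<close>

typedef unit_interval = "{0..1::real}"
  morphisms of_unit to_unit
  by force

instantiation unit_interval :: metric_space
begin

definition dist_unit_interval :: "unit_interval \<Rightarrow> unit_interval \<Rightarrow> real"
  where "dist_unit_interval x y = dist (of_unit x) (of_unit y)"

definition uniformity_unit_interval :: "(unit_interval \<times> unit_interval) filter"
  where "uniformity_unit_interval = (INF e\<in>{0 <..}. principal {(x, y). dist x y < e})"

definition open_unit_interval :: "unit_interval set \<Rightarrow> bool"
  where "open_unit_interval S = (\<forall>x\<in>S. \<forall>\<^sub>F (x', y) in uniformity. x' = x \<longrightarrow> y \<in> S)"

instance
  by standard
    (auto simp: dist_unit_interval_def uniformity_unit_interval_def open_unit_interval_def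
      of_unit_inject dist_triangle2)

end

lemma continuous_on_of_unit: "continuous_on UNIV of_unit"
  by (auto simp: continuous_on_iff dist_unit_interval_def)

lemma continuous_on_to_unit: "continuous_on {0..1} to_unit"
  by (auto simp: continuous_on_iff dist_unit_interval_def to_unit_inverse)

lemma compact_UNIV_unit_interval: "compact (UNIV :: unit_interval set)"
proof -
  have "UNIV = to_unit ` {0..1}"
    by (metis UNIV_eq_I image_eqI of_unit of_unit_inverse)
  then show ?thesis
    by (metis compact_continuous_image[OF continuous_on_to_unit] compact_Icc)
qed

text \<open>
  Boundedness is automatic on \<open>[0,1]\<close>, so the library type of bounded continuous functions, with
  its supremum norm, is exactly \<open>C[0,1]\<close>.
\<close>

type_synonym C01 = "unit_interval \<Rightarrow>\<^sub>C real"

instance bcontfun :: (metric_space, banach) banach ..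

lemma bcontfun_unit_interval:
  "(bcontfun :: (unit_interval \<Rightarrow> real) set) = {f. continuous_on UNIV f}"
  using compact_continuous_image[OF _ compact_UNIV_unit_interval]
  by (auto simp: bcontfun_def intro: compact_imp_bounded)

text \<open>
  Meaningful for positive exponents only: since \<open>0 powr 0 = 0\<close>, the exponent \<open>0\<close> does not
  give the constant function \<open>1\<close>.
\<close>

definition power_fun :: "real \<Rightarrow> C01"
  where "power_fun a = Bcontfun (\<lambda>x. of_unit x powr a)"

lemma apply_power_fun:
  assumes "a > 0"
  shows "apply_bcontfun (power_fun a) x = of_unit x powr a"
proof -
  have "continuous_on UNIV (\<lambda>x. of_unit x powr a)"
    using assms of_unit
    by (intro continuous_on_powr' continuous_on_of_unit continuous_on_const) auto
  then show ?thesis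
    by (simp add: power_fun_def Bcontfun_inverse bcontfun_unit_interval)
qed

section \<open>Normed spaces with explicit carrier\<close>

text \<open>
  A quotient by a variable subspace is not a type, so quotients and the Daugavet property are
  expressed for normed spaces given by a carrier set and explicit operations.
\<close>

record 'a nspace =
  ns_carrier :: "'a set"
  ns_zero :: 'a
  ns_add :: "'a \<Rightarrow> 'a \<Rightarrow> 'a"
  ns_scale :: "real \<Rightarrow> 'a \<Rightarrow> 'a"
  ns_norm :: "'a \<Rightarrow> real"

definition bounded_operator :: "'a nspace \<Rightarrow> ('a \<Rightarrow> 'a) \<Rightarrow> bool"
  where "bounded_operator X T \<longleftrightarrow>
    (\<forall>x \<in> ns_carrier X. T x \<in> ns_carrier X) \<and>
    (\<forall>x \<in> ns_carrier X. \<forall>y \<in> ns_carrier X. T (ns_add X x y) = ns_add X (T x) (T y)) \<and>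
    (\<forall>c. \<forall>x \<in> ns_carrier X. T (ns_scale X c x) = ns_scale X c (T x)) \<and>
    (\<exists>K. \<forall>x \<in> ns_carrier X. ns_norm X (T x) \<le> K * ns_norm X x)"

definition rank_one_operator :: "'a nspace \<Rightarrow> ('a \<Rightarrow> 'a) \<Rightarrow> bool"
  where "rank_one_operator X T \<longleftrightarrow> bounded_operator X T \<and>
    (\<exists>e \<in> ns_carrier X. e \<noteq> ns_zero X \<and> T ` ns_carrier X = range (\<lambda>c. ns_scale X c e))"

definition operator_norm :: "'a nspace \<Rightarrow> ('a \<Rightarrow> 'a) \<Rightarrow> real"
  where "operator_norm X T = (SUP x \<in> {x \<in> ns_carrier X. ns_norm X x \<le> 1}. ns_norm X (T x))"

definition daugavet_property :: "'a nspace \<Rightarrow> bool"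
  where "daugavet_property X \<longleftrightarrow>
    (\<forall>T. rank_one_operator X T \<longrightarrow>
      operator_norm X (\<lambda>x. ns_add X x (T x)) = 1 + operator_norm X T)"

section \<open>Quotient spaces and poor subspaces\<close>

text \<open>
  The points are the cosets \<open>x +o W\<close>; \<open>A + B\<close> is the elementwise sum of two cosets. Adding \<open>W\<close> in
  the scalar multiplication only matters for the scalar \<open>0\<close>.
\<close>

definition quotient_space :: "'a::real_normed_vector set \<Rightarrow> 'a set nspace"
  where "quotient_space W =
    \<lparr> ns_carrier = range (\<lambda>x. x +o W),
      ns_zero = W,
      ns_add = (\<lambda>A B. A + B),
      ns_scale = (\<lambda>c A. (*\<^sub>R) c ` A + W),
      ns_norm = (\<lambda>A. INF x \<in> A. norm x) \<rparr>"

lemma quotient_space_add: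
  assumes "subspace W"
  shows "ns_add (quotient_space W) (x +o W) (y +o W) = (x + y) +o W"
proof -
  have "W + W = W"
    using assms by (auto simp: set_plus_def intro: subspace_add)
      (metis add_0 subspace_0)
  then show ?thesis
    by (simp add: quotient_space_def set_plus_rearrange)
qed

lemma quotient_space_scale:
  assumes "subspace W"
  shows "ns_scale (quotient_space W) c (x +o W) = (c *\<^sub>R x) +o W"
proof -
  have "\<exists>a. (\<exists>w\<in>W. a = c *\<^sub>R (x + w)) \<and> (\<exists>b\<in>W. c *\<^sub>R x + v = a + b)" if "v \<in> W" for v
    using that subspace_0[OF assms] by (intro exI[of _ "c *\<^sub>R x"]) force
  moreover have "\<exists>v\<in>W. c *\<^sub>R (x + w) + b = c *\<^sub>R x + v" if "w \<in> W" "b \<in> W" for w b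
    using that assms
    by (intro bexI[of _ "c *\<^sub>R w + b"]) (auto simp: algebra_simps intro: subspace_add subspace_scale)
  ultimately show ?thesis
    by (fastforce simp: quotient_space_def elt_set_plus_def set_plus_def)
qed

lemma quotient_space_norm:
  assumes "subspace W"
  shows "ns_norm (quotient_space W) (x +o W) = infdist x W"
proof -
  have "uminus ` W = W"
    using assms by (force simp: image_iff dest: subspace_neg intro: bexI[of _ "- _"])
  moreover have "x +o W = (\<lambda>w. x + w) ` W"
    by (auto simp: elt_set_plus_def)
  ultimately have "x +o W = (\<lambda>w. x - w) ` W"
    by (metis (no_types, lifting) image_cong image_image diff_conv_add_uminus)
  moreover have "W \<noteq> {}"
    using subspace_0[OF assms] by auto
  ultimately show ?thesis
    by (simp add: quotient_space_def infdist_def dist_norm image_image)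
qed

text \<open>
  The standing hypotheses that the ambient Banach space has the Daugavet property and that \<open>Z\<close> is a
  closed subspace are deliberately not part of the predicate, so that its negation always means
  that some quotient by a closed subspace of \<open>Z\<close> fails to have the Daugavet property.
\<close>

definition poor_subspace :: "'a::banach set \<Rightarrow> bool"
  where "poor_subspace Z \<longleftrightarrow>
    (\<forall>W. subspace W \<and> closed W \<and> W \<subseteq> Z \<longrightarrow> daugavet_property (quotient_space W))"

definition muntz_space :: "(nat \<Rightarrow> real) \<Rightarrow> C01 set"
  where "muntz_space l = closure (span (insert (const_bcontfun 1) (range (\<lambda>i. power_fun (l i)))))"

end

theory Submission
  imports Defs "HOL-Real_Asymp.Real_Asymp"
begin

text \<open>
  Let \<open>W\<close> be the subspace of the functions in \<open>Z\<close> that vanish at \<open>1\<close>, and let \<open>T\<close> be the rank-one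
  operator on \<open>C[0,1]/W\<close> that sends the class of \<open>f\<close> to the class of the constant \<open>-f(1)\<close>. Evaluation
  at \<open>1\<close> has norm \<open>1\<close> on the quotient and so does the class of the constant \<open>1\<close>, hence \<open>\<parallel>T\<parallel> = 1\<close>.
  On the other hand \<open>f - f(1)\<close> can be close to \<open>2\<parallel>f\<parallel>\<close> in absolute value only away from \<open>1\<close> and only
  with the sign opposite to that of \<open>f(1)\<close>. For large \<open>n\<close> the function \<open>1 - x\<^sup>\<lambda>\<close> with \<open>\<lambda> = \<lambda>\<^sub>n\<close>
  belongs to \<open>W\<close>, takes values in \<open>[0,1]\<close> and is at least \<open>1/2\<close> away from \<open>1\<close>; adding a multiple of
  it by \<open>\<plusminus>\<parallel>f\<parallel>/2\<close> brings the norm down to \<open>7/4 \<parallel>f\<parallel>\<close>. Thus \<open>\<parallel>Id + T\<parallel> \<le> 7/4 < 1 + \<parallel>T\<parallel>\<close>.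
\<close>

lemma bounded_linear_apply_bcontfun:
  "bounded_linear (\<lambda>f :: 'a::topological_space \<Rightarrow>\<^sub>C 'b::real_normed_vector. apply_bcontfun f x)"
  by (rule bounded_linear_intro[where K = 1]) (auto simp: norm_bounded)

lemma subspace_closure:
  fixes S :: "'a::real_normed_vector set"
  assumes "subspace S"
  shows "subspace (closure S)"
proof (rule subspaceI)
  show "0 \<in> closure S"
    using subspace_0[OF assms] closure_subset by blast
  show "x + y \<in> closure S" if xy: "x \<in> closure S" "y \<in> closure S" for x y
  proof -
    obtain f g where "\<forall>n. f n \<in> S" "f \<longlonglongrightarrow> x" "\<forall>n. g n \<in> S" "g \<longlonglongrightarrow> y"
      using xy unfolding closure_sequential by blast
    then show ?thesis
      unfolding closure_sequential
      by (intro exI[of _ "\<lambda>n. f n + g n"]) (auto intro: tendsto_add subspace_add[OF assms])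
  qed
  show "c *\<^sub>R x \<in> closure S" if x: "x \<in> closure S" for c x
  proof -
    obtain f where "\<forall>n. f n \<in> S" "f \<longlonglongrightarrow> x"
      using x unfolding closure_sequential by blast
    then show ?thesis
      unfolding closure_sequential
      by (intro exI[of _ "\<lambda>n. c *\<^sub>R f n"])
        (auto intro: tendsto_scaleR subspace_scale[OF assms])
  qed
qed

lemma const_bcontfun_scaleR: "const_bcontfun c = c *\<^sub>R const_bcontfun (1::real)"
  by (rule bcontfun_eqI) simp

text \<open>An infimum dominates every lower bound. Nonemptiness matters, since
  \<open>infdist x {}\<close> is 0 by convention.\<close>

lemma le_infdistI:
  assumes "W \<noteq> {}" and "\<And>w. w \<in> W \<Longrightarrow> c \<le> dist x w"
  shows "c \<le> infdist x W"
  using assms by (simp add: infdist_def cINF_greatest)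

text \<open>Subtracting an element of \<open>W\<close> does not change the value at
  \<open>a\<close>, so evaluation at \<open>a\<close> descends to the quotient with norm at most
  1.\<close>

lemma abs_apply_le_infdist:
  fixes f :: "'a::topological_space \<Rightarrow>\<^sub>C real"
  assumes "W \<noteq> {}" and "\<And>w. w \<in> W \<Longrightarrow> apply_bcontfun w a = 0"
  shows "\<bar>apply_bcontfun f a\<bar> \<le> infdist f W"
proof (rule le_infdistI[OF assms(1)])
  show "\<bar>apply_bcontfun f a\<bar> \<le> dist f w" if "w \<in> W" for w
    using dist_bounded[of f a w] assms(2)[OF that] by (simp add: dist_real_def)
qed

text \<open>The bound is first proved with \<open>norm g\<close> on the right: a multiple of a
  function from \<open>ex\<close> corrects \<open>g - g(a)\<close> where it is large. Applying this
  to all \<open>f - w\<close> turns the norm into the quotient norm.\<close>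

lemma infdist_diff_const_le:
  fixes f :: "'a::topological_space \<Rightarrow>\<^sub>C real"
  assumes "subspace W" and "\<And>w. w \<in> W \<Longrightarrow> apply_bcontfun w a = 0"
    and ex: "\<And>U. open U \<Longrightarrow> a \<in> U \<Longrightarrow> \<exists>w\<in>W. \<forall>x. 0 \<le> apply_bcontfun w x \<and> apply_bcontfun w x \<le> 1 \<and>
      (x \<notin> U \<longrightarrow> 1/2 \<le> apply_bcontfun w x)"
  shows "infdist (f - const_bcontfun (apply_bcontfun f a)) W \<le> 7/4 * infdist f W"
proof -
  have *: "infdist (g - const_bcontfun (apply_bcontfun g a)) W \<le> 7/4 * norm g"
    for g :: "'a \<Rightarrow>\<^sub>C real"
  proof (cases "g = 0")
    case True
    then have "g - const_bcontfun (apply_bcontfun g a) = 0"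
      by (intro bcontfun_eqI) simp
    then show ?thesis
      using True subspace_0[OF assms(1)] by simp
  next
    case False
    define M where "M = norm g"
    have "M > 0"
      using False by (simp add: M_def)
    have bound: "\<bar>apply_bcontfun g x\<bar> \<le> M" for x
      using norm_bounded[of g x] by (simp add: M_def)
    define U where "U = {x. \<bar>apply_bcontfun g x - apply_bcontfun g a\<bar> < M}"
    have "open U"
      unfolding U_def by (intro open_Collect_less continuous_intros) auto
    moreover have "a \<in> U"
      using \<open>M > 0\<close> by (simp add: U_def)
    ultimately obtain w where w: "w \<in> W" "\<And>x. 0 \<le> apply_bcontfun w x" "\<And>x. apply_bcontfun w x \<le> 1"
        "\<And>x. x \<notin> U \<Longrightarrow> 1/2 \<le> apply_bcontfun w x"
      using ex by blast
    \<comment> \<open>As |g| \<le> M, the difference g - g(a) lies in [-2M, M] if g(a) \<ge> 0 and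
      in [-M, 2M] otherwise. Hence the correction \<open>- v\<close> carries the sign of
      g(a).\<close>
    define s :: real where "s = (if apply_bcontfun g a \<ge> 0 then 1 else - 1)"
    define v where "v = (- (s * M / 2)) *\<^sub>R w"
    have "v \<in> W"
      unfolding v_def using assms(1) w(1) by (rule subspace_scale)
    have "norm (g - const_bcontfun (apply_bcontfun g a) - v) \<le> 7/4 * M"
    proof (rule norm_bound)
      fix x
      define p where "p = M * apply_bcontfun w x"
      have "0 \<le> p" "p \<le> M"
        using w(2,3)[of x] \<open>M > 0\<close> by (simp_all add: p_def mult_left_le)
      \<comment> \<open>On \<open>U\<close>, and on the short side of the interval, the corrected
        value is at most M + M/2 in size. On the long side off \<open>U\<close> the correction p/2
        \<ge> M/4 leaves at most 2M - M/4 = 7M/4.\<close>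
      moreover have "\<bar>apply_bcontfun g x - apply_bcontfun g a\<bar> < M \<or> M / 2 \<le> p"
        using mult_left_mono[OF w(4)[of x], of M] \<open>M > 0\<close> by (auto simp: U_def p_def)
      ultimately have "\<bar>apply_bcontfun g x - apply_bcontfun g a + s * p / 2\<bar> \<le> 7/4 * M"
        using bound[of x] bound[of a] by (auto simp: s_def abs_if split: if_splits)
      then show "norm (apply_bcontfun (g - const_bcontfun (apply_bcontfun g a) - v) x) \<le> 7/4 * M"
        by (simp add: v_def p_def mult.assoc)
    qed
    then show ?thesis
      using infdist_le[OF \<open>v \<in> W\<close>, of "g - const_bcontfun (apply_bcontfun g a)"]
      by (simp add: M_def dist_norm)
  qed
  \<comment> \<open>Replacing \<open>f\<close> by \<open>f - w\<close> keeps the value at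
    \<open>a\<close> and changes \<open>f - f(a)\<close> only by an element of \<open>W\<close>,
    which the distance to \<open>W\<close> ignores.\<close>
  have "infdist (f - const_bcontfun (apply_bcontfun f a)) W \<le> 7/4 * dist f w" if "w \<in> W" for w
  proof -
    have "apply_bcontfun (f - w) a = apply_bcontfun f a"
      using assms(2)[OF that] by simp
    then have eq: "f - const_bcontfun (apply_bcontfun f a) = (f - w - const_bcontfun (apply_bcontfun (f - w) a)) + w"
      by simp
    have "infdist (h + w) W \<le> infdist h W" for h
    proof -
      have "infdist (h + w) W \<le> dist h u" if "u \<in> W" for u
        using infdist_le[OF subspace_add[OF assms(1) that \<open>w \<in> W\<close>], of "h + w"] by simp
      then show ?thesis
        using \<open>w \<in> W\<close> by (intro le_infdistI) auto
    qed
    then show ?thesis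
      using *[of "f - w"] unfolding eq dist_norm by (meson order_trans)
  qed
  then have "4/7 * infdist (f - const_bcontfun (apply_bcontfun f a)) W \<le> dist f w" if "w \<in> W" for w
    using that by fastforce
  moreover have "W \<noteq> {}"
    using subspace_0[OF assms(1)] by auto
  ultimately have "4/7 * infdist (f - const_bcontfun (apply_bcontfun f a)) W \<le> infdist f W"
    by (intro le_infdistI)
  then show ?thesis
    by simp
qed

text \<open>The operator induced by f \<mapsto> -f(a) has norm at least 1, while adding it to the
  identity gives norm at most 7/4 by \<open>infdist_diff_const_le\<close>.\<close>

lemma not_daugavet_property_quotient_space:
  fixes W :: "('a::topological_space \<Rightarrow>\<^sub>C real) set"
  assumes W: "subspace W" and zero: "\<And>w. w \<in> W \<Longrightarrow> apply_bcontfun w a = 0"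
    and ex: "\<And>U. open U \<Longrightarrow> a \<in> U \<Longrightarrow> \<exists>w\<in>W. \<forall>x. 0 \<le> apply_bcontfun w x \<and> apply_bcontfun w x \<le> 1 \<and>
      (x \<notin> U \<longrightarrow> 1/2 \<le> apply_bcontfun w x)"
  shows "\<not> daugavet_property (quotient_space W)"
proof
  assume daugavet: "daugavet_property (quotient_space W)"
  let ?Q = "quotient_space W" and ?c = "const_bcontfun :: real \<Rightarrow> 'a \<Rightarrow>\<^sub>C real"
  have "0 \<in> W"
    using W by (rule subspace_0)
  then have "W \<noteq> {}"
    by auto
  note le_infdist = abs_apply_le_infdist[OF \<open>W \<noteq> {}\<close> zero]
  have carrier: "ns_carrier ?Q = range (\<lambda>f. f +o W)" and Q0: "ns_zero ?Q = W"
    by (simp_all add: quotient_space_def)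
  note Q = carrier Q0 quotient_space_add[OF W] quotient_space_scale[OF W] quotient_space_norm[OF W]
  \<comment> \<open>Any representative of a coset will do: two of them differ by an element of
    \<open>W\<close>, which vanishes at \<open>a\<close>.\<close>
  define T where "T A = ?c (- apply_bcontfun (SOME f. f \<in> A) a) +o W" for A
  have T: "T (f +o W) = ?c (- apply_bcontfun f a) +o W" for f
  proof -
    have "f \<in> f +o W"
      using \<open>0 \<in> W\<close> by (auto simp: elt_set_plus_def)
    then have "(SOME g. g \<in> f +o W) \<in> f +o W"
      by (metis someI)
    then have "apply_bcontfun (SOME g. g \<in> f +o W) a = apply_bcontfun f a"
      using zero by (auto simp: elt_set_plus_def)
    then show ?thesis
      by (simp add: T_def)
  qed
  have norm_T: "infdist (?c (- apply_bcontfun f a)) W \<le> infdist f W" for f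
  proof -
    have "infdist (?c (- apply_bcontfun f a)) W \<le> norm (?c (- apply_bcontfun f a))"
      using infdist_le[OF \<open>0 \<in> W\<close>] by (simp add: dist_norm)
    also have "\<dots> \<le> \<bar>apply_bcontfun f a\<bar>"
      by (rule norm_bound) simp
    also have "\<dots> \<le> infdist f W"
      by (rule le_infdist)
    finally show ?thesis .
  qed
  have "bounded_operator ?Q T"
    unfolding bounded_operator_def
  proof (intro conjI)
    show "\<exists>K. \<forall>A\<in>ns_carrier ?Q. ns_norm ?Q (T A) \<le> K * ns_norm ?Q A"
      by (rule exI[of _ 1]) (auto simp: Q T norm_T)
    have "?c (- x - y) = ?c (- x) + ?c (- y)" for x y
      by (rule bcontfun_eqI) simp
    then show "\<forall>A\<in>ns_carrier ?Q. \<forall>B\<in>ns_carrier ?Q. T (ns_add ?Q A B) = ns_add ?Q (T A) (T B)"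
      by (auto simp: Q T)
    have "?c (- (r * x)) = r *\<^sub>R ?c (- x)" for r x
      by (rule bcontfun_eqI) simp
    then show "\<forall>r. \<forall>A\<in>ns_carrier ?Q. T (ns_scale ?Q r A) = ns_scale ?Q r (T A)"
      by (auto simp: Q T)
  qed (auto simp: Q T)
  moreover have "\<exists>E\<in>ns_carrier ?Q. E \<noteq> ns_zero ?Q \<and> T ` ns_carrier ?Q = range (\<lambda>r. ns_scale ?Q r E)"
  proof (intro bexI conjI)
    show "?c 1 +o W \<in> ns_carrier ?Q"
      by (simp add: Q)
    have "?c 1 \<in> ?c 1 +o W"
      using \<open>0 \<in> W\<close> by (auto simp: elt_set_plus_def)
    moreover have "?c 1 \<notin> W"
      using zero[of "?c 1"] by auto
    ultimately show "?c 1 +o W \<noteq> ns_zero ?Q"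
      by (auto simp: Q)
    have "range (\<lambda>f. ?c (- apply_bcontfun f a) +o W) = range (\<lambda>r. ?c r +o W)"
    proof (rule antisym)
      show "range (\<lambda>r. ?c r +o W) \<subseteq> range (\<lambda>f. ?c (- apply_bcontfun f a) +o W)"
      proof
        fix A
        assume "A \<in> range (\<lambda>r. ?c r +o W)"
        then obtain r where "A = ?c r +o W"
          by auto
        then show "A \<in> range (\<lambda>f. ?c (- apply_bcontfun f a) +o W)"
          by (intro image_eqI[of _ _ "?c (- r)"]) auto
      qed
    qed auto
    then show "T ` ns_carrier ?Q = range (\<lambda>r. ns_scale ?Q r (?c 1 +o W))"
      by (simp add: Q T image_image const_bcontfun_scaleR[symmetric])
  qed
  ultimately have "rank_one_operator ?Q T"
    by (auto simp: rank_one_operator_def)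
  then have eq: "operator_norm ?Q (\<lambda>A. ns_add ?Q A (T A)) = 1 + operator_norm ?Q T"
    using daugavet by (auto simp: daugavet_property_def)
  \<comment> \<open>The class of the constant 1 is the witness: its image is the class of -1, whose
    norm is at least 1 by evaluation at \<open>a\<close>.\<close>
  have "1 \<le> operator_norm ?Q T"
    unfolding operator_norm_def
  proof (rule cSUP_upper2)
    show "bdd_above ((\<lambda>A. ns_norm ?Q (T A)) ` {A \<in> ns_carrier ?Q. ns_norm ?Q A \<le> 1})"
      by (rule bdd_aboveI2[of _ _ 1]) (auto simp: Q T intro: order_trans[OF norm_T])
    have "norm (?c 1) \<le> 1"
      by (rule norm_bound) simp
    then show "?c 1 +o W \<in> {A \<in> ns_carrier ?Q. ns_norm ?Q A \<le> 1}"
      using infdist_le[OF \<open>0 \<in> W\<close>, of "?c 1"] by (simp add: Q)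
    show "1 \<le> ns_norm ?Q (T (?c 1 +o W))"
      using le_infdist[of "?c (- 1)"] by (simp add: Q T)
  qed
  moreover have "operator_norm ?Q (\<lambda>A. ns_add ?Q A (T A)) \<le> 7/4"
    unfolding operator_norm_def
  proof (rule cSUP_least)
    have "0 +o W \<in> {A \<in> ns_carrier ?Q. ns_norm ?Q A \<le> 1}"
      using \<open>0 \<in> W\<close> by (simp add: Q del: set_zero_plus)
    then show "{A \<in> ns_carrier ?Q. ns_norm ?Q A \<le> 1} \<noteq> {}"
      by blast
    fix A
    assume "A \<in> {A \<in> ns_carrier ?Q. ns_norm ?Q A \<le> 1}"
    then obtain f where f: "A = f +o W" "infdist f W \<le> 1"
      by (auto simp: Q)
    have "f + ?c (- apply_bcontfun f a) = f - ?c (apply_bcontfun f a)"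
      by (rule bcontfun_eqI) simp
    then show "ns_norm ?Q (ns_add ?Q A (T A)) \<le> 7/4"
      using infdist_diff_const_le[OF W zero ex, of f] f by (simp add: Q T)
  qed
  ultimately show False
    using eq by simp
qed

theorem theorem3p1:
  fixes \<Lambda> :: "nat \<Rightarrow> real"
  assumes "strict_mono \<Lambda>"
    and "\<And>i. \<Lambda> i > 0"
    and "filterlim \<Lambda> at_top sequentially"
  shows "\<not> poor_subspace (muntz_space \<Lambda>)"
proof -
  let ?Z = "muntz_space \<Lambda>" and ?one = "to_unit 1"
  define W where "W = ?Z \<inter> (\<lambda>f. apply_bcontfun f ?one) -` {0}"
  have of_1: "of_unit ?one = 1"
    by (simp add: to_unit_inverse)
  have Z: "subspace ?Z"
    unfolding muntz_space_def by (intro subspace_closure subspace_span)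
  have sub: "subspace W"
    using Z by (auto simp: W_def subspace_def)
  have "closed W"
    unfolding W_def muntz_space_def
    by (intro closed_Int closed_closure closed_vimage closed_singleton
        linear_continuous_on[OF bounded_linear_apply_bcontfun])
  moreover have "\<not> daugavet_property (quotient_space W)"
  proof (rule not_daugavet_property_quotient_space[OF sub])
    show "apply_bcontfun w ?one = 0" if "w \<in> W" for w
      using that by (simp add: W_def)
    fix U
    assume "open U" "?one \<in> U"
    then obtain e where e: "e > 0" "\<And>x. dist x ?one < e \<Longrightarrow> x \<in> U"
      by (meson open_dist)
    \<comment> \<open>Points outside \<open>U\<close> lie in [0, 1 - e]. The maximum with 1/2 keeps
      \<open>r\<close> positive even when e \<ge> 1.\<close>
    define r where "r = max (1 - e) (1/2)"
    have r: "0 < r" "r < 1"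
      using e(1) by (auto simp: r_def)
    have "((\<lambda>n. r powr \<Lambda> n) \<longlongrightarrow> 0) sequentially"
    proof (rule filterlim_compose[OF _ assms(3)])
      show "((\<lambda>t. r powr t) \<longlongrightarrow> 0) at_top"
        using r by real_asymp
    qed
    then have "\<forall>\<^sub>F n in sequentially. r powr \<Lambda> n < 1/2"
      by (rule order_tendstoD) simp
    then obtain n where n: "r powr \<Lambda> n < 1/2"
      by (meson eventually_happens sequentially_bot)
    define w where "w = const_bcontfun 1 - power_fun (\<Lambda> n)"
    have w: "apply_bcontfun w x = 1 - of_unit x powr \<Lambda> n" for x
      by (simp add: w_def apply_power_fun assms(2))
    have "const_bcontfun 1 \<in> ?Z" "power_fun (\<Lambda> n) \<in> ?Z"
      unfolding muntz_space_def by (auto intro!: subsetD[OF closure_subset] span_base)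
    then have "w \<in> ?Z"
      unfolding w_def by (rule subspace_diff[OF Z])
    then have "w \<in> W"
      by (simp add: W_def w of_1)
    moreover have "0 \<le> apply_bcontfun w x" "apply_bcontfun w x \<le> 1" for x
      using of_unit[of x] assms(2)[of n] by (auto simp: w intro: powr_le1)
    moreover have "1/2 \<le> apply_bcontfun w x" if "x \<notin> U" for x
    proof -
      have "e \<le> dist x ?one"
        using e(2) that by force
      \<comment> \<open>Powers with positive exponent increase on [0,1], so the smallness at
        \<open>r\<close> passes to every point outside \<open>U\<close>.\<close>
      then have "of_unit x \<le> r"
        using of_unit[of x] by (auto simp: r_def dist_unit_interval_def of_1 dist_real_def)
      then have "of_unit x powr \<Lambda> n \<le> r powr \<Lambda> n"
        using of_unit[of x] assms(2)[of n] by (intro powr_mono2) auto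
      then show ?thesis
        using n by (simp add: w)
    qed
    ultimately show "\<exists>w\<in>W. \<forall>x. 0 \<le> apply_bcontfun w x \<and> apply_bcontfun w x \<le> 1 \<and>
        (x \<notin> U \<longrightarrow> 1/2 \<le> apply_bcontfun w x)"
      by blast
  qed
  ultimately show ?thesis
    using sub by (auto simp: poor_subspace_def W_def)
qed

end
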